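(* Let $x_1,x_2,x_3,x_4\in\mathbb{R}^3$ be the vertices of a quadrilateral inscribed in a circle. Then $$|D(x_1,x_2,x_3,x_4)|^{2}\ \ge\ |D(x_2,x_3,x_4)|\cdot|D(x_1,x_3,x_4)|\cdot|D(x_1,x_2,x_4)|\cdot|D(x_1,x_2,x_3)|.$$
   Context: $D$ denotes the Atiyah determinant, defined for any number $n$ of distinct points as follows. Let $x_1,\ldots,x_n$ be distinct points of $\mathbb{R}^3$, with $x_i=(x_{i,1},x_{i,2},x_{i,3})$. For each pair $i<j$ choose complex numbers $z_{i,j},w_{i,j}$ with $|z_{i,j}|^2+|w_{i,j}|^2=1$ and $$\frac{z_{i,j}}{w_{i,j}}=\frac{(x_{j,1}-x_{i,1})+(x_{j,2}-x_{i,2})\sqrt{-1}}{\sqrt{\sum_{k=1}^3(x_{j,k}-x_{i,k})^2}-(x_{j,3}-x_{i,3})},$$ with the convention that $w_{i,j}=0$ when the denominator of the right-hand side vanishes. For $i>j$ put $z_{i,j}=-\overline{w_{j,i}}$ and $w_{i,j}=\overline{z_{j,i}}$. Let $a_{i,j}$ be the coefficient of $t_1^{j-1}t_2^{n-j}$ in the polynomial $f_i(t_1,t_2)=\prod_{k\ne i}(z_{i,k}t_1-w_{i,k}t_2)$. Then $D(x_1,\ldots,x_n)=\det(a_{i,j})_{1\le i,j\le n}$; this number is known to be independent of the choices made. *)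

theory Defs
  imports "HOL-Analysis.Analysis" "Jordan_Normal_Form.Determinant"
begin

no_notation vec_index (infixl \<open>$\<close> 100)
no_notation scalar_prod (infix \<open>\<bullet>\<close> 70)

text \<open>Lists are indexed from 0, so the points \<open>x\<^sub>1, \<dots>, x\<^sub>n\<close> are
  \<open>xs ! 0, \<dots>, xs ! (n - 1)\<close>.  The requirement \<open>w i j \<noteq> 0\<close> is needed because
  \<open>z / 0 = 0\<close> in HOL: without it, \<open>w i j = 0\<close> would be admitted when the
  prescribed ratio is 0.\<close>

definition atiyah_choice ::
  "(real^3) list \<Rightarrow> (nat \<Rightarrow> nat \<Rightarrow> complex) \<Rightarrow> (nat \<Rightarrow> nat \<Rightarrow> complex) \<Rightarrow> bool" where
  "atiyah_choice xs z w \<longleftrightarrow>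
     (\<forall>i j. i < j \<longrightarrow> j < length xs \<longrightarrow>
        (let v = xs ! j - xs ! i; d = norm v - v $ 3 in
           (cmod (z i j))\<^sup>2 + (cmod (w i j))\<^sup>2 = 1 \<and>
           (if d = 0 then w i j = 0
            else w i j \<noteq> 0 \<and> z i j / w i j = Complex (v $ 1) (v $ 2) / of_real d)) \<and>
        z j i = - cnj (w i j) \<and> w j i = cnj (z i j))"

text \<open>Polynomials in \<open>t\<^sub>1, t\<^sub>2\<close> are represented as polynomials in \<open>t\<^sub>1\<close> (outer)
  whose coefficients are polynomials in \<open>t\<^sub>2\<close> (inner); the factor below is
  \<open>z i k * t\<^sub>1 - w i k * t\<^sub>2\<close>.\<close>

definition atiyah_poly ::
  "nat \<Rightarrow> (nat \<Rightarrow> nat \<Rightarrow> complex) \<Rightarrow> (nat \<Rightarrow> nat \<Rightarrow> complex) \<Rightarrow> nat \<Rightarrow> complex poly poly" where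
  "atiyah_poly n z w i = (\<Prod>k\<in>{..<n} - {i}. [: [: 0, - w i k :], [: z i k :] :])"

text \<open>Column \<open>j\<close>, counted from 0, holds the coefficient of \<open>t\<^sub>1\<^sup>j t\<^sub>2\<^sup>n\<^sup>-\<^sup>1\<^sup>-\<^sup>j\<close>.\<close>

definition atiyah_mat ::
  "nat \<Rightarrow> (nat \<Rightarrow> nat \<Rightarrow> complex) \<Rightarrow> (nat \<Rightarrow> nat \<Rightarrow> complex) \<Rightarrow> complex mat" where
  "atiyah_mat n z w =
     mat n n (\<lambda>(i, j). poly.coeff (poly.coeff (atiyah_poly n z w i) j) (n - 1 - j))"

text \<open>Existence and uniqueness of the described value are shown in
  \<open>atiyah_choice_exists\<close> and \<open>atiyah_det_eq\<close> below.\<close>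

definition atiyah_det :: "(real^3) list \<Rightarrow> complex" where
  "atiyah_det xs =
     (THE D. \<exists>z w. atiyah_choice xs z w \<and> D = Determinant.det (atiyah_mat (length xs) z w))"

definition is_circle :: "(real^3) set \<Rightarrow> bool" where
  "is_circle S \<longleftrightarrow>
     (\<exists>c n r. r > 0 \<and> n \<noteq> 0 \<and> S = {p. dist c p = r \<and> inner n (p - c) = 0})"

lemma unit_pair_exists:
  fixes N :: complex and d :: real
  shows "\<exists>z w. (cmod z)\<^sup>2 + (cmod w)\<^sup>2 = 1 \<and>
    (if d = 0 then w = 0 else w \<noteq> 0 \<and> z / w = N / of_real d)"
proof (cases "d = 0")
  case True
  then show ?thesis by (intro exI[of _ 1] exI[of _ 0]) auto
next
  case False
  define s where "s = sqrt ((cmod N)\<^sup>2 + d\<^sup>2)"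
  have s: "s > 0" "s\<^sup>2 = (cmod N)\<^sup>2 + d\<^sup>2"
    using False by (auto simp: s_def add_nonneg_pos)
  have "(cmod (N / of_real s))\<^sup>2 + (cmod (of_real (d / s)))\<^sup>2 = ((cmod N)\<^sup>2 + d\<^sup>2) / s\<^sup>2"
    by (simp add: norm_divide power_divide add_divide_distrib)
  also have "\<dots> = 1" using s(1) unfolding s(2)[symmetric] by simp
  finally show ?thesis
    using s(1) False
    by (intro exI[of _ "N / of_real s"] exI[of _ "of_real (d / s)"]) auto
qed

lemma atiyah_choice_exists: "\<exists>z w. atiyah_choice xs z w"
proof -
  define P where "P i j zw \<longleftrightarrow>
    (let v = xs ! j - xs ! i; d = norm v - v $ 3 in
       (cmod (fst zw))\<^sup>2 + (cmod (snd zw))\<^sup>2 = 1 \<and>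
       (if d = 0 then snd zw = 0
        else snd zw \<noteq> 0 \<and> fst zw / snd zw = Complex (v $ 1) (v $ 2) / of_real d))"
    for i j :: nat and zw :: "complex \<times> complex"
  have "\<exists>zw. P i j zw" for i j
    using unit_pair_exists[where d = "norm (xs ! j - xs ! i) - (xs ! j - xs ! i) $ 3"
        and N = "Complex ((xs ! j - xs ! i) $ 1) ((xs ! j - xs ! i) $ 2)"]
    unfolding P_def Let_def split_paired_Ex fst_conv snd_conv .
  then obtain g where g: "P i j (g i j)" for i j by metis
  define z where "z i j = (if i < j then fst (g i j) else - cnj (snd (g j i)))" for i j
  define w where "w i j = (if i < j then snd (g i j) else cnj (fst (g j i)))" for i j
  have "atiyah_choice xs z w"
    unfolding atiyah_choice_def
  proof (intro allI impI)
    fix i j :: nat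
    assume ij: "i < j" "j < length xs"
    have zw: "z i j = fst (g i j)" "w i j = snd (g i j)"
      "z j i = - cnj (w i j)" "w j i = cnj (z i j)"
      using ij by (auto simp: z_def w_def)
    show "(let v = xs ! j - xs ! i; d = norm v - v $ 3 in
           (cmod (z i j))\<^sup>2 + (cmod (w i j))\<^sup>2 = 1 \<and>
           (if d = 0 then w i j = 0
            else w i j \<noteq> 0 \<and> z i j / w i j = Complex (v $ 1) (v $ 2) / of_real d)) \<and>
        z j i = - cnj (w i j) \<and> w j i = cnj (z i j)"
      using g[of i j] zw(3,4) unfolding P_def zw(1,2) Let_def by argo
  qed
  then show ?thesis by blast
qed

lemma unit_pair_unique:
  fixes z w z' w' N :: complex and d :: real
  assumes "(cmod z)\<^sup>2 + (cmod w)\<^sup>2 = 1" "(cmod z')\<^sup>2 + (cmod w')\<^sup>2 = 1"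
    and "if d = 0 then w = 0 else w \<noteq> 0 \<and> z / w = N / of_real d"
    and "if d = 0 then w' = 0 else w' \<noteq> 0 \<and> z' / w' = N / of_real d"
  shows "\<exists>u. cmod u = 1 \<and> z' = u * z \<and> w' = u * w"
proof (cases "d = 0")
  case True
  then have *: "w = 0" "w' = 0" using assms by auto
  then have "cmod z = 1" "cmod z' = 1"
    using assms by (auto simp: power2_eq_1_iff) (use norm_ge_zero[of z] norm_ge_zero[of z'] in linarith)+
  then show ?thesis
    using * by (intro exI[of _ "z' / z"]) (auto simp: norm_divide)
next
  case False
  define q where "q = N / of_real d"
  have nz: "w \<noteq> 0" "w' \<noteq> 0" and zq: "z = q * w" "z' = q * w'"
    using assms False by (auto simp: q_def field_simps)
  have "(cmod w)\<^sup>2 * ((cmod q)\<^sup>2 + 1) = 1" "(cmod w')\<^sup>2 * ((cmod q)\<^sup>2 + 1) = 1"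
    using assms zq by (auto simp: norm_mult power_mult_distrib algebra_simps)
  moreover have "(cmod q)\<^sup>2 + 1 \<noteq> 0" by (simp add: add_nonneg_eq_0_iff)
  ultimately have "(cmod w)\<^sup>2 = (cmod w')\<^sup>2"
    by (metis mult_right_cancel)
  then have "cmod w = cmod w'" by simp
  then show ?thesis
    using nz zq by (intro exI[of _ "w' / w"]) (auto simp: norm_divide)
qed

lemma prod_off_diagonal:
  fixes u :: "nat \<Rightarrow> nat \<Rightarrow> 'a::comm_monoid_mult"
  assumes "\<And>i j. i < j \<Longrightarrow> j < n \<Longrightarrow> u i j * u j i = 1"
  shows "(\<Prod>i<n. \<Prod>k\<in>{..<n} - {i}. u i k) = 1"
  using assms
proof (induction n)
  case (Suc n)
  have "(\<Prod>k\<in>{..<Suc n} - {i}. u i k) = u i n * (\<Prod>k\<in>{..<n} - {i}. u i k)" if "i < n" for i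
  proof -
    have "{..<Suc n} - {i} = insert n ({..<n} - {i})" using that by auto
    then show ?thesis by simp
  qed
  moreover have "{..<Suc n} - {n} = {..<n}" by auto
  ultimately have "(\<Prod>i<Suc n. \<Prod>k\<in>{..<Suc n} - {i}. u i k)
      = (\<Prod>i<n. u i n * u n i) * (\<Prod>i<n. \<Prod>k\<in>{..<n} - {i}. u i k)"
    by (simp add: prod.distrib ac_simps)
  then show ?case using Suc by simp
qed simp

lemma det_atiyah_mat_unique:
  assumes "atiyah_choice xs z w" "atiyah_choice xs z' w'"
  shows "Determinant.det (atiyah_mat (length xs) z' w') = Determinant.det (atiyah_mat (length xs) z w)"
proof -
  define n where "n = length xs"
  have "\<exists>u. i < j \<longrightarrow> j < n \<longrightarrow> cmod u = 1 \<and> z' i j = u * z i j \<and> w' i j = u * w i j" for i j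
  proof (cases "i < j \<and> j < n")
    case True
    have "\<exists>u. cmod u = 1 \<and> z' i j = u * z i j \<and> w' i j = u * w i j"
      using assms True unfolding atiyah_choice_def Let_def n_def
      by (intro unit_pair_unique[where d = "norm (xs ! j - xs ! i) - (xs ! j - xs ! i) $ 3"
            and N = "Complex ((xs ! j - xs ! i) $ 1) ((xs ! j - xs ! i) $ 2)"]) presburger+
    then show ?thesis by blast
  qed auto
  then obtain g where g: "i < j \<Longrightarrow> j < n \<Longrightarrow>
      cmod (g i j) = 1 \<and> z' i j = g i j * z i j \<and> w' i j = g i j * w i j" for i j
    by metis
  define u where "u i j = (if i < j then g i j else cnj (g j i))" for i j
  have u1: "u i j * u j i = 1" if "i < j" "j < n" for i j
    using g[OF that] that by (simp add: u_def complex_norm_square[symmetric])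
  have zw: "z' i j = u i j * z i j \<and> w' i j = u i j * w i j" if "i < n" "j < n" "i \<noteq> j" for i j
  proof (cases "i < j")
    case True
    then show ?thesis using g that by (simp add: u_def)
  next
    case False
    then have ji: "j < i" using that by simp
    have "z i j = - cnj (w j i)" "w i j = cnj (z j i)"
         "z' i j = - cnj (w' j i)" "w' i j = cnj (z' j i)"
      using assms ji that unfolding atiyah_choice_def n_def by blast+
    then show ?thesis using g[OF ji \<open>i < n\<close>] ji by (simp add: u_def)
  qed
  define U where "U i = (\<Prod>k\<in>{..<n} - {i}. u i k)" for i
  have f: "atiyah_poly n z' w' i = [: [: U i :] :] * atiyah_poly n z w i" if "i < n" for i
  proof -
    have "atiyah_poly n z' w' i
        = (\<Prod>k\<in>{..<n} - {i}. [: [: u i k :] :] * [: [: 0, - w i k :], [: z i k :] :])"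
      unfolding atiyah_poly_def using zw that by (intro prod.cong) auto
    also have "\<dots> = (\<Prod>k\<in>{..<n} - {i}. [: [: u i k :] :]) * atiyah_poly n z w i"
      unfolding atiyah_poly_def by (rule prod.distrib)
    also have "(\<Prod>k\<in>A. [: [: u i k :] :]) = [: [: prod (u i) A :] :]" for A
      by (induction A rule: infinite_finite_induct) (auto simp: one_pCons)
    finally show ?thesis by (simp add: U_def)
  qed
  define A where "A = atiyah_mat n z w"
  define A' where "A' = atiyah_mat n z' w'"
  have car: "A \<in> carrier_mat n n" "A' \<in> carrier_mat n n"
    by (auto simp: A_def A'_def atiyah_mat_def)
  have ent: "A' $$ (i, j) = U i * A $$ (i, j)" if "i < n" "j < n" for i j
    using that by (simp add: A_def A'_def atiyah_mat_def f)
  have U1: "(\<Prod>i = 0..<n. U i) = 1"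
    using prod_off_diagonal[of n u] u1 by (simp add: U_def atLeast0LessThan)
  have "(\<Prod>i = 0..<n. A' $$ (i, p i)) = (\<Prod>i = 0..<n. A $$ (i, p i))"
    if "p permutes {0..<n}" for p
  proof -
    have "(\<Prod>i = 0..<n. A' $$ (i, p i)) = (\<Prod>i = 0..<n. U i * A $$ (i, p i))"
      using permutes_in_image[OF that] by (intro prod.cong refl ent) auto
    then show ?thesis by (simp add: prod.distrib U1)
  qed
  then have "Determinant.det A' = Determinant.det A"
    unfolding det_def'[OF car(1)] det_def'[OF car(2)] by (intro sum.cong refl) auto
  then show ?thesis by (simp add: A_def A'_def n_def)
qed

lemma atiyah_det_eq:
  assumes "atiyah_choice xs z w"
  shows "atiyah_det xs = Determinant.det (atiyah_mat (length xs) z w)"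
  unfolding atiyah_det_def
  using assms by (intro the_equality) (auto intro: det_atiyah_mat_unique)

end

theory Submission
  imports Defs
begin

text \<open>A unit vector \<open>n\<close> of \<open>\<real>\<^sup>3\<close> is the image under the Hopf map of a unit spinor \<open>(z, w)\<close>, unique
  up to a phase, and the pairs \<open>(z i j, w i j)\<close> in the definition of \<open>D\<close> are spinors over the
  directions from \<open>x i\<close> to \<open>x j\<close>.  Changing phases multiplies the rows of the matrix by numbers
  of modulus 1, so \<open>|D|\<close> can be computed from any choice of such spinors (\<open>cmod_atiyah_det\<close>).
  In particular \<open>|D|\<close> does not depend on the order of the points, and the four points may be
  taken in their cyclic order on the circle.

  A rotation acts on spinors through a 2-by-2 matrix of determinant 1, hence on the coefficient
  matrix by a symmetric power of it, again of determinant 1 (\<open>det_atiyah_mat_frame_3\<close>,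
  \<open>det_atiyah_mat_frame_4\<close>).  So the plane of the circle may be taken to be the horizontal one.
  There the spinor of a direction with unit complex number \<open>u\<close> is \<open>(u, 1) / sqrt 2\<close>.  The chord
  from \<open>exp (i s)\<close> to \<open>exp (i t)\<close>, where \<open>s < t < s + 2 pi\<close>, has direction
  \<open>i exp (i s / 2) exp (i t / 2)\<close>; these products make the determinants explicit
  polynomials in the numbers \<open>exp (i t / 2)\<close> (\<open>det_cocircular_3\<close>, \<open>det_cocircular_4\<close>).

  For each of the four triangles let \<open>\<alpha>\<close>, \<open>\<beta>\<close> be the inscribed angles over the two sides whose
  arcs do not contain the fourth point, so that \<open>\<alpha> + \<beta> < pi\<close>,
  and put \<open>P = (cos \<alpha> + cos \<beta> - cos (\<alpha> + \<beta>) - 1) / 4\<close> and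
  \<open>C = (3 + cos \<alpha> + cos \<beta> + cos (\<alpha> + \<beta>)) / 2\<close>.  In terms of these numbers the triangle has
  \<open>|D| = 1 + P\<close>, and the quadrilateral has \<open>|D| = 1 + (\<Sum> P C) / 2\<close>, summed over the four triangles.
  Now \<open>P = sin (\<alpha>/2) sin (\<beta>/2) cos ((\<alpha> + \<beta>)/2) \<ge> 0\<close>, and \<open>C - (1 + 2 P) = 1 + cos (\<alpha> + \<beta>) \<ge> 0\<close>.
  With \<open>s = \<Sum> P\<close> this gives \<open>|D| \<ge> 1 + s/2 + \<Sum> P\<^sup>2 \<ge> (1 + s/4)\<^sup>2\<close> for the quadrilateral, while
  the product of the four numbers \<open>1 + P\<close> is at most \<open>(1 + s/4)\<^sup>4\<close> by the inequality of the
  arithmetic and geometric means; \<open>product_le_square\<close> carries this out, grouping the four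
  factors into two pairs.\<close>

section \<open>Spinors over directions\<close>

text \<open>The Hopf map from the unit sphere of \<open>\<complex>\<^sup>2\<close> onto the unit sphere of \<open>\<real>\<^sup>3\<close>.  It replaces the
  stereographic ratio \<open>z / w\<close>, and it needs no exceptional case at the pole.\<close>

definition hopf :: "complex \<Rightarrow> complex \<Rightarrow> real^3" where
  "hopf z w = vector [2 * Re (z * cnj w), 2 * Im (z * cnj w), (cmod z)\<^sup>2 - (cmod w)\<^sup>2]"

text \<open>A choice of spinors with independent phases: unlike \<open>atiyah_choice\<close>, no relation between the
  spinors of opposite directions is imposed, which makes the notion stable under reordering.\<close>

definition direction_spinors ::
  "(real^3) list \<Rightarrow> (nat \<Rightarrow> nat \<Rightarrow> complex) \<Rightarrow> (nat \<Rightarrow> nat \<Rightarrow> complex) \<Rightarrow> bool" where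
  "direction_spinors xs z w \<longleftrightarrow>
     (\<forall>i<length xs. \<forall>j<length xs. i \<noteq> j \<longrightarrow>
        (cmod (z i j))\<^sup>2 + (cmod (w i j))\<^sup>2 = 1 \<and>
        norm (xs ! j - xs ! i) *\<^sub>R hopf (z i j) (w i j) = xs ! j - xs ! i)"

lemma hopf_eqI:
  assumes "2 * (z * cnj w) = Complex (v $ 1) (v $ 2)" "(cmod z)\<^sup>2 - (cmod w)\<^sup>2 = v $ 3"
  shows "hopf z w = v"
proof -
  have "2 * Re (z * cnj w) = v $ 1" "2 * Im (z * cnj w) = v $ 2"
    using arg_cong[OF assms(1), of Re] arg_cong[OF assms(1), of Im] by simp_all
  then show ?thesis using assms(2) unfolding hopf_def by (simp add: Finite_Cartesian_Product.vec_eq_iff forall_3)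
qed

lemma hopf_nth:
  "hopf z w $ 1 = 2 * Re (z * cnj w)" "hopf z w $ 2 = 2 * Im (z * cnj w)"
  "hopf z w $ 3 = (cmod z)\<^sup>2 - (cmod w)\<^sup>2"
  by (simp_all add: hopf_def)

text \<open>The involution that the definition of \<open>D\<close> uses for \<open>i > j\<close> reverses the direction.\<close>

lemma hopf_antipode: "hopf (- cnj w) (cnj z) = - hopf z w"
  by (simp add: Finite_Cartesian_Product.vec_eq_iff forall_3 hopf_nth algebra_simps)

lemma norm_vec3: "(norm v)\<^sup>2 = (v $ 1)\<^sup>2 + (v $ 2)\<^sup>2 + (v $ 3)\<^sup>2" for v :: "real^3"
  unfolding power2_norm_eq_inner by (simp add: inner_vec_def sum_3 power2_eq_square)

lemma norm_hopf:
  assumes "(cmod z)\<^sup>2 + (cmod w)\<^sup>2 = 1"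
  shows "norm (hopf z w) = 1"
proof -
  have "(norm (hopf z w))\<^sup>2 = 4 * (cmod (z * cnj w))\<^sup>2 + ((cmod z)\<^sup>2 - (cmod w)\<^sup>2)\<^sup>2"
    unfolding norm_vec3 hopf_nth cmod_power2[of "z * cnj w"] by (simp add: power2_eq_square algebra_simps)
  also have "\<dots> = ((cmod z)\<^sup>2 + (cmod w)\<^sup>2)\<^sup>2"
    by (simp add: norm_mult power2_eq_square algebra_simps)
  finally show ?thesis using assms by (simp add: power2_eq_1_iff) (use norm_ge_zero[of "hopf z w"] in linarith)
qed

text \<open>Stereographic projection inverts the Hopf map: with \<open>N = v\<^sub>1 + i v\<^sub>2\<close> and \<open>d = |v| - v\<^sub>3\<close> one has
  \<open>|N|\<^sup>2 + d\<^sup>2 = 2 |v| d\<close>, so that normalisation of \<open>(N, d)\<close> forces \<open>2 |v| |w|\<^sup>2 = d\<close>.\<close>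

lemma stereographic_hopf:
  fixes v :: "real^3"
  assumes unit: "(cmod z)\<^sup>2 + (cmod w)\<^sup>2 = 1"
    and ratio: "if norm v - v $ 3 = 0 then w = 0
      else w \<noteq> 0 \<and> z / w = Complex (v $ 1) (v $ 2) / of_real (norm v - v $ 3)"
  shows "norm v *\<^sub>R hopf z w = v"
proof (cases "norm v - v $ 3 = 0")
  case True
  then have "(v $ 1)\<^sup>2 + (v $ 2)\<^sup>2 = 0" "w = 0"
    using norm_vec3[of v] ratio by auto
  then show ?thesis using True unit
    by (simp add: Finite_Cartesian_Product.vec_eq_iff forall_3 hopf_nth sum_power2_eq_zero_iff)
next
  case False
  define N d where "N = Complex (v $ 1) (v $ 2)" and "d = norm v - v $ 3"
  have d: "d \<noteq> 0" "w \<noteq> 0" using False ratio by (auto simp: d_def)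
  have z: "z = N * w / of_real d" using ratio d by (auto simp: N_def d_def field_simps)
  have N: "(cmod N)\<^sup>2 + d\<^sup>2 = 2 * norm v * d"
    using norm_vec3[of v] by (simp add: N_def d_def cmod_def power2_eq_square algebra_simps)
  have "(cmod z)\<^sup>2 * d\<^sup>2 = (cmod N)\<^sup>2 * (cmod w)\<^sup>2"
    using d by (simp add: z norm_mult norm_divide power_mult_distrib power_divide)
  moreover have "(cmod z)\<^sup>2 = 1 - (cmod w)\<^sup>2" using unit by simp
  ultimately have "(cmod w)\<^sup>2 * ((cmod N)\<^sup>2 + d\<^sup>2) = d\<^sup>2"
    by (simp add: algebra_simps)
  then have w: "2 * norm v * (cmod w)\<^sup>2 = d"
    using d unfolding N by (simp add: power2_eq_square[of d] mult_ac)
  have "of_real (norm v) * (2 * (z * cnj w)) = N * of_real (2 * norm v * (cmod w)\<^sup>2) / of_real d"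
    unfolding z by (simp add: complex_norm_square algebra_simps del: of_real_power)
  then have "of_real (norm v) * (2 * (z * cnj w)) = N" unfolding w using d by simp
  from arg_cong[OF this, of Re] arg_cong[OF this, of Im]
  have "norm v * (2 * Re (z * cnj w)) = v $ 1" "norm v * (2 * Im (z * cnj w)) = v $ 2"
    by (simp_all add: N_def)
  moreover have "norm v * ((cmod z)\<^sup>2 - (cmod w)\<^sup>2) = norm v - 2 * norm v * (cmod w)\<^sup>2"
  proof -
    have "(cmod z)\<^sup>2 = 1 - (cmod w)\<^sup>2" using unit by simp
    then show ?thesis by (simp only:) (simp add: algebra_simps)
  qed
  ultimately show ?thesis
    using w by (simp add: Finite_Cartesian_Product.vec_eq_iff forall_3 hopf_nth d_def)
qed

lemma hopf_surj:
  fixes v :: "real^3"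
  assumes "norm v = 1"
  obtains z w where "(cmod z)\<^sup>2 + (cmod w)\<^sup>2 = 1" "hopf z w = v"
proof -
  obtain z w where "(cmod z)\<^sup>2 + (cmod w)\<^sup>2 = 1"
    "if norm v - v $ 3 = 0 then w = 0
      else w \<noteq> 0 \<and> z / w = Complex (v $ 1) (v $ 2) / of_real (norm v - v $ 3)"
    using unit_pair_exists by blast
  then show ?thesis using that stereographic_hopf[of z w v] assms by simp
qed

text \<open>The fibres of the Hopf map are circles; the phase is the Hermitian product of the two spinors.\<close>

lemma hopf_phase:
  assumes "(cmod z)\<^sup>2 + (cmod w)\<^sup>2 = 1" "(cmod z')\<^sup>2 + (cmod w')\<^sup>2 = 1" "hopf z w = hopf z' w'"
  obtains u where "cmod u = 1" "z' = u * z" "w' = u * w"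
proof -
  have "Re (z * cnj w) = Re (z' * cnj w')" "Im (z * cnj w) = Im (z' * cnj w')"
    "(cmod z)\<^sup>2 - (cmod w)\<^sup>2 = (cmod z')\<^sup>2 - (cmod w')\<^sup>2"
    using assms(3) by (simp_all add: Finite_Cartesian_Product.vec_eq_iff forall_3 hopf_nth)
  then have c: "z * cnj w = z' * cnj w'" "(cmod z)\<^sup>2 = (cmod z')\<^sup>2" "(cmod w)\<^sup>2 = (cmod w')\<^sup>2"
    using assms(1,2) by (intro complex_eqI, argo+)
  have one: "z * cnj z + w * cnj w = 1" "z' * cnj z' + w' * cnj w' = 1"
     "z * cnj z = z' * cnj z'" "w * cnj w = w' * cnj w'"
    using assms(1,2) c(2,3) by (simp_all add: complex_norm_square[symmetric] flip: of_real_add of_real_power)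
  have c': "w * cnj z = w' * cnj z'" using arg_cong[OF c(1), of cnj] by (simp add: mult.commute)
  define u where "u = z' * cnj z + w' * cnj w"
  have "u * z = z' * (z * cnj z) + w' * (z * cnj w)" "u * w = z' * (w * cnj z) + w' * (w * cnj w)"
    by (simp_all add: u_def algebra_simps)
  then have "u * z = z' * (z' * cnj z' + w' * cnj w')" "u * w = w' * (z' * cnj z' + w' * cnj w')"
    unfolding c(1) one(3,4) c' by (simp_all add: algebra_simps)
  then have uz: "z' = u * z" "w' = u * w" unfolding one by simp_all
  have "(cmod u)\<^sup>2 * ((cmod z)\<^sup>2 + (cmod w)\<^sup>2) = 1"
    using assms(2) by (simp add: uz norm_mult power_mult_distrib algebra_simps)
  then have "(cmod u)\<^sup>2 = 1" using assms(1) by simp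
  then have "cmod u = 1" by (simp add: power2_eq_1_iff) (use norm_ge_zero[of u] in linarith)
  then show ?thesis using uz that by blast
qed

lemma atiyah_choice_direction_spinors:
  assumes "atiyah_choice xs z w"
  shows "direction_spinors xs z w"
proof -
  have *: "(cmod (z i j))\<^sup>2 + (cmod (w i j))\<^sup>2 = 1"
    "norm (xs ! j - xs ! i) *\<^sub>R hopf (z i j) (w i j) = xs ! j - xs ! i"
    "z j i = - cnj (w i j)" "w j i = cnj (z i j)"
    if "i < j" "j < length xs" for i j
    using assms that stereographic_hopf[of "z i j" "w i j" "xs ! j - xs ! i"]
    unfolding atiyah_choice_def Let_def by blast+
  have "(cmod (z i j))\<^sup>2 + (cmod (w i j))\<^sup>2 = 1 \<and>
        norm (xs ! j - xs ! i) *\<^sub>R hopf (z i j) (w i j) = xs ! j - xs ! i"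
    if "i < length xs" "j < length xs" "i \<noteq> j" for i j
  proof (cases "i < j")
    case False
    then have ji: "j < i" using that by simp
    note jj = *[OF ji \<open>i < length xs\<close>]
    have "norm (xs ! j - xs ! i) *\<^sub>R hopf (z i j) (w i j)
        = - (norm (xs ! i - xs ! j) *\<^sub>R hopf (z j i) (w j i))"
      using jj(3,4) by (simp add: hopf_antipode norm_minus_commute)
    then show ?thesis using jj by (simp add: add.commute)
  qed (use * that in auto)
  then show ?thesis by (simp add: direction_spinors_def)
qed

section \<open>Phases and the order of the points\<close>

text \<open>Row \<open>i\<close> of the matrix is multiplied by the product of the phases \<open>u i k\<close> over \<open>k\<close>.\<close>

lemma cmod_det_rephase:
  assumes u: "\<And>i j. i < n \<Longrightarrow> j < n \<Longrightarrow> i \<noteq> j \<Longrightarrow>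
      cmod (u i j) = 1 \<and> z' i j = u i j * z i j \<and> w' i j = u i j * w i j"
  shows "cmod (Determinant.det (atiyah_mat n z' w')) = cmod (Determinant.det (atiyah_mat n z w))"
proof -
  define U where "U i = (\<Prod>k\<in>{..<n} - {i}. u i k)" for i
  have U1: "cmod (U i) = 1" if "i < n" for i
    using u that by (auto simp: U_def prod_norm[symmetric] intro!: prod.neutral)
  have const: "(\<Prod>k\<in>K. [: [: u i k :] :]) = [: [: prod (u i) K :] :]" for K i
    by (induction K rule: infinite_finite_induct) (auto simp: one_pCons)
  have f: "atiyah_poly n z' w' i = [: [: U i :] :] * atiyah_poly n z w i" if "i < n" for i
  proof -
    have "atiyah_poly n z' w' i
        = (\<Prod>k\<in>{..<n} - {i}. [: [: u i k :] :] * [: [: 0, - w i k :], [: z i k :] :])"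
      unfolding atiyah_poly_def using u that by (intro prod.cong) auto
    also have "\<dots> = (\<Prod>k\<in>{..<n} - {i}. [: [: u i k :] :]) * atiyah_poly n z w i"
      unfolding atiyah_poly_def by (rule prod.distrib)
    finally show ?thesis unfolding const U_def .
  qed
  have "atiyah_mat n z' w' = mat\<^sub>r n n (\<lambda>i. U i \<cdot>\<^sub>v row (atiyah_mat n z w) i)"
    by (rule eq_matI) (auto simp: atiyah_mat_def f)
  also have "Determinant.det \<dots> = prod U {0..<n} * Determinant.det (mat\<^sub>r n n (row (atiyah_mat n z w)))"
    by (rule det_rows_mul) (auto simp: atiyah_mat_def)
  also have "mat\<^sub>r n n (row (atiyah_mat n z w)) = atiyah_mat n z w"
    by (rule eq_matI) (auto simp: atiyah_mat_def)
  finally show ?thesis using U1 by (simp add: norm_mult prod_norm[symmetric])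
qed

lemma cmod_atiyah_det:
  assumes "distinct xs" "direction_spinors xs z w"
  shows "cmod (atiyah_det xs) = cmod (Determinant.det (atiyah_mat (length xs) z w))"
proof -
  obtain z0 w0 where zw0: "atiyah_choice xs z0 w0" using atiyah_choice_exists by blast
  have "\<exists>u. i < length xs \<longrightarrow> j < length xs \<longrightarrow> i \<noteq> j \<longrightarrow>
      cmod u = 1 \<and> z i j = u * z0 i j \<and> w i j = u * w0 i j" for i j
  proof (cases "i < length xs \<and> j < length xs \<and> i \<noteq> j")
    case True
    then have "norm (xs ! j - xs ! i) \<noteq> 0" using assms(1) by (simp add: nth_eq_iff_index_eq)
    moreover have "norm (xs ! j - xs ! i) *\<^sub>R hopf (z0 i j) (w0 i j)
         = norm (xs ! j - xs ! i) *\<^sub>R hopf (z i j) (w i j)"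
      using True assms(2) atiyah_choice_direction_spinors[OF zw0]
      by (simp add: direction_spinors_def)
    ultimately have "hopf (z0 i j) (w0 i j) = hopf (z i j) (w i j)" by simp
    then show ?thesis
      using hopf_phase[of "z0 i j" "w0 i j" "z i j" "w i j"] True assms(2)
        atiyah_choice_direction_spinors[OF zw0]
      unfolding direction_spinors_def by metis
  qed blast
  then obtain u where "i < length xs \<Longrightarrow> j < length xs \<Longrightarrow> i \<noteq> j \<Longrightarrow>
      cmod (u i j) = 1 \<and> z i j = u i j * z0 i j \<and> w i j = u i j * w0 i j" for i j
    by metis
  from cmod_det_rephase[OF this] show ?thesis by (simp add: atiyah_det_eq[OF zw0])
qed

text \<open>Reordering the points permutes the rows, once the spinors are reordered along with the points.\<close>

lemma cmod_atiyah_det_permute: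
  assumes "distinct xs" "mset ys = mset xs"
  shows "cmod (atiyah_det ys) = cmod (atiyah_det xs)"
proof -
  define n where "n = length xs"
  obtain p where p: "p permutes {..<n}" "permute_list p xs = ys"
    using mset_eq_permutation[OF assms(2)] unfolding n_def by blast
  have len: "length ys = n" using assms(2) mset_eq_length n_def by metis
  have d: "distinct ys" using assms mset_eq_imp_distinct_iff by blast
  have nth: "ys ! i = xs ! p i" if "i < n" for i
    using permute_list_nth[of p xs i] p that n_def by simp
  have pn: "p i < n" if "i < n" for i using permutes_in_image[OF p(1)] that by simp
  have inj: "p i = p j \<longleftrightarrow> i = j" for i j using permutes_inj[OF p(1)] by (simp add: inj_eq)
  obtain z w where zw: "direction_spinors xs z w"
    using atiyah_choice_exists atiyah_choice_direction_spinors by blast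
  define z' w' where "z' = (\<lambda>i j. z (p i) (p j))" and "w' = (\<lambda>i j. w (p i) (p j))"
  have "direction_spinors ys z' w'"
    using zw by (simp add: direction_spinors_def z'_def w'_def len nth pn inj n_def[symmetric])
  have poly: "atiyah_poly n z' w' i = atiyah_poly n z w (p i)" if "i < n" for i
  proof -
    have "bij_betw p ({..<n} - {i}) ({..<n} - {p i})"
      using p(1) that by (auto intro!: bij_betw_DiffI simp: permutes_imp_bij pn)
    then show ?thesis unfolding atiyah_poly_def z'_def w'_def
      by (rule prod.reindex_bij_betw)
  qed
  have "atiyah_mat n z' w' = mat n n (\<lambda>(i, j). atiyah_mat n z w $$ (p i, j))"
    by (rule eq_matI) (auto simp: atiyah_mat_def poly pn)
  also have "Determinant.det \<dots> = signof p * Determinant.det (atiyah_mat n z w)"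
    using p(1) by (intro det_permute_rows) (auto simp: atiyah_mat_def lessThan_atLeast0)
  finally have "cmod (Determinant.det (atiyah_mat n z' w')) = cmod (Determinant.det (atiyah_mat n z w))"
    by (simp add: norm_mult sign_def)
  then show ?thesis
    using cmod_atiyah_det[OF assms(1) zw] cmod_atiyah_det[OF d \<open>direction_spinors ys z' w'\<close>]
    by (simp add: len n_def)
qed

section \<open>Coefficient matrices for three and four points\<close>

lemma det_mat_Suc:
  fixes f :: "nat \<times> nat \<Rightarrow> 'a::comm_ring_1"
  shows "Determinant.det (mat (Suc n) (Suc n) f) =
    (\<Sum>k<Suc n. (- 1) ^ k * f (0, k) *
       Determinant.det (mat n n (\<lambda>(i, j). f (Suc i, if j < k then j else Suc j))))"
proof -
  have "mat_delete (mat (Suc n) (Suc n) f) 0 k =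
      mat n n (\<lambda>(i, j). f (Suc i, if j < k then j else Suc j))" for k
    by (rule eq_matI) (auto simp: mat_delete_def)
  then show ?thesis
    by (subst laplace_expansion_row[of _ "Suc n" 0])
       (auto simp: cofactor_def mult_ac intro!: sum.cong)
qed

lemma det_mat_2:
  fixes f :: "nat \<times> nat \<Rightarrow> 'a::comm_ring_1"
  shows "Determinant.det (mat 2 2 f) = f (0, 0) * f (1, 1) - f (0, 1) * f (1, 0)"
  using det_mat_Suc[of 1 f] by (simp add: det_single numeral_2_eq_2)

lemma det_mat_3:
  fixes f :: "nat \<times> nat \<Rightarrow> 'a::comm_ring_1"
  shows "Determinant.det (mat 3 3 f) =
     f (0,0) * (f (1,1) * f (2,2) - f (1,2) * f (2,1))
   - f (0,1) * (f (1,0) * f (2,2) - f (1,2) * f (2,0))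
   + f (0,2) * (f (1,0) * f (2,1) - f (1,1) * f (2,0))"
  using det_mat_Suc[of 2 f]
  by (simp add: det_mat_2 numeral_3_eq_3[symmetric] lessThan_nat_numeral lessThan_Suc numeral_2_eq_2[symmetric])

lemma det_mat_4:
  fixes f :: "nat \<times> nat \<Rightarrow> 'a::comm_ring_1"
  shows "Determinant.det (mat 4 4 f) =
    (\<Sum>k<4. (- 1) ^ k * f (0, k) *
       Determinant.det (mat 3 3 (\<lambda>(i, j). f (Suc i, if j < k then j else Suc j))))"
  using det_mat_Suc[of 3 f] by simp

lemma linear_form_mult_2:
  "[: [: 0, - b :], [: a :] :] * [: [: 0, - d :], [: c :] :] =
   [: [: 0, 0, b * d :], [: 0, - (a * d + b * c) :], [: a * c :] :]" for a b c d :: complex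
  by simp

lemma linear_form_mult_3:
  "[: [: 0, - b :], [: a :] :] * ([: [: 0, - d :], [: c :] :] * [: [: 0, - f :], [: e :] :]) =
   [: [: 0, 0, 0, - (b * d * f) :], [: 0, 0, a * d * f + b * c * f + b * d * e :],
      [: 0, - (a * c * f + a * d * e + b * c * e) :], [: a * c * e :] :]" for a b c d e f :: complex
  unfolding linear_form_mult_2 by (simp add: algebra_simps)

lemma atiyah_mat_3:
  assumes "{i, k, l} = {..<3}" "distinct [i, k, l]" "j < 3"
  shows "atiyah_mat 3 z w $$ (i, j) =
    [w i k * w i l, - (z i k * w i l + w i k * z i l), z i k * z i l] ! j"
proof -
  have "{..<3} - {i} = {k, l}" using assms(1,2) by auto
  then have "atiyah_poly 3 z w i =
      [: [: 0, - w i k :], [: z i k :] :] * [: [: 0, - w i l :], [: z i l :] :]"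
    unfolding atiyah_poly_def using assms(2) by simp
  moreover have "i < 3" using assms(1) by blast
  moreover have "j = 0 \<or> j = 1 \<or> j = 2" using assms(3) by linarith
  ultimately show ?thesis using assms(3) unfolding linear_form_mult_2 atiyah_mat_def
    by (elim disjE) (simp_all add: numeral_2_eq_2)
qed

lemma atiyah_mat_4:
  assumes "{i, k, l, m} = {..<4}" "distinct [i, k, l, m]" "j < 4"
  shows "atiyah_mat 4 z w $$ (i, j) =
    [- (w i k * w i l * w i m),
     z i k * w i l * w i m + w i k * z i l * w i m + w i k * w i l * z i m,
     - (z i k * z i l * w i m + z i k * w i l * z i m + w i k * z i l * z i m),
     z i k * z i l * z i m] ! j"
proof -
  have "{..<4} - {i} = {k, l, m}" using assms(1,2) by auto
  then have "atiyah_poly 4 z w i =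
      [: [: 0, - w i k :], [: z i k :] :] * ([: [: 0, - w i l :], [: z i l :] :] *
      [: [: 0, - w i m :], [: z i m :] :])"
    unfolding atiyah_poly_def using assms(2) by simp
  moreover have "i < 4" using assms(1) by blast
  moreover have "j = 0 \<or> j = 1 \<or> j = 2 \<or> j = 3" using assms(3) by linarith
  ultimately show ?thesis using assms(3) unfolding linear_form_mult_3 atiyah_mat_def
    by (elim disjE) (simp_all add: numeral_2_eq_2 numeral_3_eq_3)
qed

section \<open>Change of frame\<close>

text \<open>With \<open>T\<^sub>1 = p t\<^sub>1 - q t\<^sub>2\<close> and \<open>T\<^sub>2 = q' t\<^sub>1 + p' t\<^sub>2\<close>, the hypotheses say that
  \<open>z t\<^sub>1 - w t\<^sub>2 = u T\<^sub>1 - v T\<^sub>2\<close>.  The matrix \<open>T\<close> of the proof expresses the monomials in \<open>T\<^sub>1, T\<^sub>2\<close> by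
  those in \<open>t\<^sub>1, t\<^sub>2\<close>: it is the symmetric square of the substitution, and its determinant is the
  cube of the determinant \<open>p p' + q q'\<close> of the latter.\<close>

lemma det_atiyah_mat_frame_3:
  assumes z: "\<And>i k. z i k = p * u i k - q' * v i k"
    and w: "\<And>i k. w i k = q * u i k + p' * v i k"
  shows "Determinant.det (atiyah_mat 3 z w) = (p * p' + q * q') ^ 3 * Determinant.det (atiyah_mat 3 u v)"
proof -
  define T where "T = mat_of_rows_list 3
     [[p'^2, 2*p'*q', q'^2], [- (q*p'), p*p' - q*q', p*q'], [q^2, - 2*p*q, p^2]]"
  have T: "T \<in> carrier_mat 3 3" by (auto simp: T_def mat_of_rows_list_def)
  have det_T: "Determinant.det T = (p * p' + q * q') ^ 3"
    unfolding T_def mat_of_rows_list_def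
    by (simp add: numeral_3_eq_3[symmetric] det_mat_3) (simp add: algebra_simps eval_nat_numeral)
  have car: "atiyah_mat 3 a b \<in> carrier_mat 3 3" for a b by (simp add: atiyah_mat_def)
  have "atiyah_mat 3 z w = atiyah_mat 3 u v * T"
  proof (rule eq_matI)
    fix i j assume "i < dim_row (atiyah_mat 3 u v * T)" "j < dim_col (atiyah_mat 3 u v * T)"
    then have ij: "i < 3" "j < 3" using T car[of u v] by auto
    have "{0,1,2} = {..<3::nat}" "{1,0,2} = {..<3::nat}" "{2,0,1} = {..<3::nat}" by auto
    moreover have "i = 0 \<or> i = 1 \<or> i = 2" using ij by linarith
    ultimately obtain k l where kl: "{i, k, l} = {..<3}" "distinct [i, k, l]"
      by (elim disjE) force+
    note row = atiyah_mat_3[OF kl]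
    have "(atiyah_mat 3 u v * T) $$ (i, j) = (\<Sum>n<3. atiyah_mat 3 u v $$ (i, n) * T $$ (n, j))"
      using ij T car[of u v] by (simp add: times_mat_def scalar_prod_def lessThan_atLeast0)
    also have "\<dots> = atiyah_mat 3 u v $$ (i, 0) * T $$ (0, j) + atiyah_mat 3 u v $$ (i, 1) * T $$ (1, j)
        + atiyah_mat 3 u v $$ (i, 2) * T $$ (2, j)"
      by (simp add: numeral_3_eq_3 numeral_2_eq_2)
    also have "\<dots> = atiyah_mat 3 z w $$ (i, j)"
    proof -
      consider "j = 0" | "j = 1" | "j = 2" using ij by linarith
      then show ?thesis
      proof cases
        case 1
        show ?thesis unfolding 1
          by (simp add: row T_def mat_of_rows_list_def z w) (simp add: algebra_simps eval_nat_numeral)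
      next
        case 2
        show ?thesis unfolding 2
          by (simp add: row T_def mat_of_rows_list_def z w) (simp add: algebra_simps eval_nat_numeral)
      next
        case 3
        show ?thesis unfolding 3
          by (simp add: row T_def mat_of_rows_list_def z w) (simp add: algebra_simps eval_nat_numeral)
      qed
    qed
    finally show "atiyah_mat 3 z w $$ (i, j) = (atiyah_mat 3 u v * T) $$ (i, j)" by simp
  qed (use T car[of u v] car[of z w] in auto)
  then show ?thesis
    using det_mult[OF car T, of u v] det_T by simp
qed

text \<open>The same for the symmetric cube of the substitution, whose determinant is the sixth power.\<close>

lemma det_atiyah_mat_frame_4:
  assumes z: "\<And>i k. z i k = p * u i k - q' * v i k"
    and w: "\<And>i k. w i k = q * u i k + p' * v i k"
  shows "Determinant.det (atiyah_mat 4 z w) = (p * p' + q * q') ^ 6 * Determinant.det (atiyah_mat 4 u v)"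
proof -
  define T where "T = mat_of_rows_list 4
     [[p'^3, 3*p'^2*q', 3*p'*q'^2, q'^3],
      [- (q*p'^2), p*p'^2 - 2*q*p'*q', 2*p*p'*q' - q*q'^2, p*q'^2],
      [q^2*p', q^2*q' - 2*p*q*p', p^2*p' - 2*p*q*q', p^2*q'],
      [- (q^3), 3*p*q^2, - (3*p^2*q), p^3]]"
  have T: "T \<in> carrier_mat 4 4" by (auto simp: T_def mat_of_rows_list_def)
  have det_T: "Determinant.det T = (p * p' + q * q') ^ 6"
  proof -
    have *: "Suc (Suc (Suc (Suc 0))) = 4" "{..<4::nat} = {0,1,2,3}" by auto
    show ?thesis
      unfolding T_def mat_of_rows_list_def
      by (simp add: * det_mat_3 det_mat_4) (simp add: algebra_simps eval_nat_numeral)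
  qed
  have car: "atiyah_mat 4 a b \<in> carrier_mat 4 4" for a b by (simp add: atiyah_mat_def)
  have "atiyah_mat 4 z w = atiyah_mat 4 u v * T"
  proof (rule eq_matI)
    fix i j assume "i < dim_row (atiyah_mat 4 u v * T)" "j < dim_col (atiyah_mat 4 u v * T)"
    then have ij: "i < 4" "j < 4" using T car[of u v] by auto
    have "{0,1,2,3} = {..<4::nat}" "{1,0,2,3} = {..<4::nat}" "{2,0,1,3} = {..<4::nat}" "{3,0,1,2} = {..<4::nat}"
      by auto
    moreover have "i = 0 \<or> i = 1 \<or> i = 2 \<or> i = 3" using ij by linarith
    ultimately obtain k l m where klm: "{i, k, l, m} = {..<4}" "distinct [i, k, l, m]"
      by (elim disjE) force+
    note row = atiyah_mat_4[OF klm]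
    have "(atiyah_mat 4 u v * T) $$ (i, j) = (\<Sum>n<4. atiyah_mat 4 u v $$ (i, n) * T $$ (n, j))"
      using ij T car[of u v] by (simp add: times_mat_def scalar_prod_def lessThan_atLeast0)
    also have "\<dots> = atiyah_mat 4 u v $$ (i, 0) * T $$ (0, j) + atiyah_mat 4 u v $$ (i, 1) * T $$ (1, j)
        + atiyah_mat 4 u v $$ (i, 2) * T $$ (2, j) + atiyah_mat 4 u v $$ (i, 3) * T $$ (3, j)"
    proof -
      have "{..<4::nat} = {0, 1, 2, 3}" by auto
      then show ?thesis by (simp add: add.assoc)
    qed
    also have "\<dots> = atiyah_mat 4 z w $$ (i, j)"
    proof -
      consider "j = 0" | "j = 1" | "j = 2" | "j = 3" using ij by linarith
      then show ?thesis
      proof cases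
        case 1
        show ?thesis unfolding 1
          by (simp add: row T_def mat_of_rows_list_def z w) (simp add: algebra_simps eval_nat_numeral)
      next
        case 2
        show ?thesis unfolding 2
          by (simp add: row T_def mat_of_rows_list_def z w) (simp add: algebra_simps eval_nat_numeral)
      next
        case 3
        show ?thesis unfolding 3
          by (simp add: row T_def mat_of_rows_list_def z w) (simp add: algebra_simps eval_nat_numeral)
      next
        case 4
        show ?thesis unfolding 4
          by (simp add: row T_def mat_of_rows_list_def z w) (simp add: algebra_simps eval_nat_numeral)
      qed
    qed
    finally show "atiyah_mat 4 z w $$ (i, j) = (atiyah_mat 4 u v * T) $$ (i, j)" by simp
  qed (use T car[of u v] car[of z w] in auto)
  then show ?thesis
    using det_mult[OF car T, of u v] det_T by simp
qed

section \<open>Determinants of cocircular points\<close>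

text \<open>The directions of the chords, up to the common factor \<open>i\<close>, are \<open>\<plusminus> s i * s k\<close> with
  \<open>s k = exp (i t\<^sub>k / 2)\<close>.  Here and for four points the right-hand side is written in terms of the sums \<open>a\<^sup>2 + b\<^sup>2\<close>, which
  become \<open>2 a b\<close> times a cosine on the unit circle.\<close>

lemma det_cocircular_3:
  assumes "u = (\<lambda>i k. (if i < k then 1 else - 1) * s i * s k)" "v = (\<lambda>i k. 1)"
   and "s 0 = a" "s 1 = b" "s 2 = c"
  shows "Determinant.det (atiyah_mat 3 u v) =
    a * b * c * (6 * a * b * c + (a^2 + b^2) * c + (b^2 + c^2) * a - (a^2 + c^2) * b)"
proof -
  have car: "atiyah_mat 3 u v = mat 3 3 (\<lambda>ij. atiyah_mat 3 u v $$ ij)"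
    by (rule eq_matI) (auto simp: atiyah_mat_def)
  have row: "{0,1,2} = {..<3::nat}" "{1,0,2} = {..<3::nat}" "{2,0,1} = {..<3::nat}" by auto
  show ?thesis
    by (subst car, simp add: det_mat_3 atiyah_mat_3[OF row(1)] atiyah_mat_3[OF row(2), simplified] atiyah_mat_3[OF row(3)]
        assms(1,2) assms(3-)[unfolded One_nat_def])
       (simp add: algebra_simps eval_nat_numeral)
qed

text \<open>Each of the last four summands belongs to a triangle, and its prefactor is the square of the
  parameter of the omitted vertex.  Its two brackets become \<open>8 P\<close> and \<open>4 C\<close> times the product of the
  parameters of the triangle.  The last two triangles have the arc from the last point back to the
  first among the two arcs in question; its inscribed angle is \<open>pi - (t\<^sub>3 - t\<^sub>0) / 2\<close>, hence the
  negative signs.\<close>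

lemma det_cocircular_4:
  assumes "u = (\<lambda>i k. (if i < k then 1 else - 1) * s i * s k)" "v = (\<lambda>i k. 1)"
   and "s 0 = a" "s 1 = b" "s 2 = c" "s 3 = d"
  shows "Determinant.det (atiyah_mat 4 u v) = (a * b * c * d) *
    (64 * (a * b * c * d)^2
     + d^2 * ((a^2 + b^2) * c + (b^2 + c^2) * a - (a^2 + c^2) * b - 2 * a * b * c)
           * (6 * a * b * c + (a^2 + b^2) * c + (b^2 + c^2) * a + (a^2 + c^2) * b)
     + a^2 * ((b^2 + c^2) * d + (c^2 + d^2) * b - (b^2 + d^2) * c - 2 * b * c * d)
           * (6 * b * c * d + (b^2 + c^2) * d + (c^2 + d^2) * b + (b^2 + d^2) * c)
     + b^2 * ((c^2 + d^2) * a - (a^2 + d^2) * c + (a^2 + c^2) * d - 2 * a * c * d)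
           * (6 * a * c * d + (c^2 + d^2) * a - (a^2 + d^2) * c - (a^2 + c^2) * d)
     + c^2 * ((a^2 + b^2) * d + (b^2 + d^2) * a - (a^2 + d^2) * b - 2 * a * b * d)
           * (6 * a * b * d + (a^2 + b^2) * d - (b^2 + d^2) * a - (a^2 + d^2) * b))"
proof -
  have car: "atiyah_mat 4 u v = mat 4 4 (\<lambda>ij. atiyah_mat 4 u v $$ ij)"
    by (rule eq_matI) (auto simp: atiyah_mat_def)
  have row: "{0,1,2,3} = {..<4::nat}" "{1,0,2,3} = {..<4::nat}" "{2,0,1,3} = {..<4::nat}" "{3,0,1,2} = {..<4::nat}" by auto
  have 4: "{..<4::nat} = {0,1,2,3}" by auto
  show ?thesis
    by (subst car, simp add: det_mat_3 det_mat_4 4 numeral_2_eq_2[symmetric]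
        atiyah_mat_4[OF row(1)] atiyah_mat_4[OF row(2), simplified] atiyah_mat_4[OF row(3)] atiyah_mat_4[OF row(4)]
        assms(1,2) assms(3-)[unfolded One_nat_def])
       (simp add: algebra_simps eval_nat_numeral)
qed

section \<open>The circle and its chords\<close>

text \<open>For a unit spinor \<open>(p, q)\<close> the vectors \<open>frame1 p q\<close>, \<open>frame2 p q\<close> and \<open>hopf p q\<close> are the columns of
  the rotation that corresponds to \<open>(p, q)\<close>.  The first two span the plane orthogonal to
  \<open>hopf p q\<close>, which is the normal direction of the plane of the circle below.\<close>

definition frame1 :: "complex \<Rightarrow> complex \<Rightarrow> real^3" where
  "frame1 p q = vector [Re (p\<^sup>2 - (cnj q)\<^sup>2), Im (p\<^sup>2 - (cnj q)\<^sup>2), - 2 * Re (p * q)]"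

definition frame2 :: "complex \<Rightarrow> complex \<Rightarrow> real^3" where
  "frame2 p q = vector [- Im (p\<^sup>2 + (cnj q)\<^sup>2), Re (p\<^sup>2 + (cnj q)\<^sup>2), 2 * Im (p * q)]"

text \<open>Orthonormality of the three vectors, in the form of the resolution of the identity.  Without the
  normalisation of \<open>(p, q)\<close> the right-hand side is \<open>(|p|\<^sup>2 + |q|\<^sup>2)\<^sup>2 v\<close>, a polynomial identity.\<close>

lemma frame_expansion:
  fixes v :: "real^3"
  assumes pq: "(cmod p)\<^sup>2 + (cmod q)\<^sup>2 = 1"
  shows "v = inner v (frame1 p q) *\<^sub>R frame1 p q + inner v (frame2 p q) *\<^sub>R frame2 p q
           + inner v (hopf p q) *\<^sub>R hopf p q" (is "v = ?r")
proof -
  obtain a b c d where [simp]: "p = Complex a b" "q = Complex c d" by (cases p, cases q)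
  have N: "a * a + b * b + c * c + d * d = 1"
    using pq unfolding cmod_power2 by (simp add: power2_eq_square)
  have "(a * a + b * b + c * c + d * d) * (a * a + b * b + c * c + d * d) * v $ k = ?r $ k"
    if "k = 1 \<or> k = 2 \<or> k = 3" for k :: 3
    using that
    unfolding hopf_def cmod_power2
    by (elim disjE) (simp_all add: frame1_def frame2_def inner_vec_def sum_3 power2_eq_square algebra_simps)
  then show ?thesis
    unfolding N Finite_Cartesian_Product.vec_eq_iff forall_3 by simp
qed

text \<open>The rotation applied to the spinor \<open>(u, 1) / sqrt 2\<close> of a horizontal direction \<open>u\<close>.\<close>

lemma hopf_equator:
  assumes u: "cmod u = 1" and pq: "(cmod p)\<^sup>2 + (cmod q)\<^sup>2 = 1"
  defines "z \<equiv> (u * p - cnj q) / of_real (sqrt 2)" and "w \<equiv> (u * q + cnj p) / of_real (sqrt 2)"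
  shows "(cmod z)\<^sup>2 + (cmod w)\<^sup>2 = 1" "hopf z w = Re u *\<^sub>R frame1 p q + Im u *\<^sub>R frame2 p q"
proof -
  have sq: "(cmod (x - y))\<^sup>2 = (cmod x)\<^sup>2 + (cmod y)\<^sup>2 - 2 * Re (x * cnj y)"
    "(cmod (x + y))\<^sup>2 = (cmod x)\<^sup>2 + (cmod y)\<^sup>2 + 2 * Re (x * cnj y)" for x y
    unfolding cmod_power2 by (simp_all add: power2_eq_square algebra_simps)
  have z: "2 * (cmod z)\<^sup>2 = 1 - 2 * Re (u * p * q)"
    using u pq by (simp add: z_def norm_divide power_divide sq norm_mult)
  have w: "2 * (cmod w)\<^sup>2 = 1 + 2 * Re (u * p * q)"
    using u pq by (simp add: w_def norm_divide power_divide sq norm_mult mult_ac)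
  show "(cmod z)\<^sup>2 + (cmod w)\<^sup>2 = 1" using z w by argo
  have "u * cnj u = 1" using u by (simp add: complex_norm_square[symmetric])
  have "2 * (z * cnj w) = (u * p - cnj q) * cnj (u * q + cnj p)"
    unfolding z_def w_def by (simp flip: of_real_mult)
  also have "\<dots> = (u * cnj u) * (p * cnj q) - p * cnj q + u * p\<^sup>2 - cnj u * (cnj q)\<^sup>2"
    by (simp add: algebra_simps power2_eq_square)
  also have "\<dots> = u * p\<^sup>2 - cnj u * (cnj q)\<^sup>2" unfolding \<open>u * cnj u = 1\<close> by simp
  finally have zw: "2 * (z * cnj w) = u * p\<^sup>2 - cnj u * (cnj q)\<^sup>2" .
  show "hopf z w = Re u *\<^sub>R frame1 p q + Im u *\<^sub>R frame2 p q"
  proof (rule hopf_eqI)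
    show "2 * (z * cnj w) = Complex ((Re u *\<^sub>R frame1 p q + Im u *\<^sub>R frame2 p q) $ 1)
        ((Re u *\<^sub>R frame1 p q + Im u *\<^sub>R frame2 p q) $ 2)"
      unfolding zw complex_eq_iff by (simp add: frame1_def frame2_def algebra_simps)
    have "(cmod z)\<^sup>2 - (cmod w)\<^sup>2 = - 2 * Re (u * (p * q))" using z w by (simp add: mult.assoc)
    then show "(cmod z)\<^sup>2 - (cmod w)\<^sup>2 = (Re u *\<^sub>R frame1 p q + Im u *\<^sub>R frame2 p q) $ 3"
      by (simp add: frame1_def frame2_def algebra_simps)
  qed
qed

definition circle_point :: "real^3 \<Rightarrow> real \<Rightarrow> complex \<Rightarrow> complex \<Rightarrow> real \<Rightarrow> real^3" where
  "circle_point c r p q t = c + r *\<^sub>R (cos t *\<^sub>R frame1 p q + sin t *\<^sub>R frame2 p q)"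

lemma circle_parametrization:
  assumes "is_circle S"
  obtains c r p q where "r > 0" "(cmod p)\<^sup>2 + (cmod q)\<^sup>2 = 1"
    "\<And>x. x \<in> S \<Longrightarrow> \<exists>t. 0 \<le> t \<and> t < 2 * pi \<and> x = circle_point c r p q t"
proof -
  obtain c n r where S: "r > 0" "n \<noteq> 0" "S = {p. dist c p = r \<and> inner n (p - c) = 0}"
    using assms unfolding is_circle_def by blast
  obtain p q where pq: "(cmod p)\<^sup>2 + (cmod q)\<^sup>2 = 1" "hopf p q = n /\<^sub>R norm n"
    using hopf_surj[of "n /\<^sub>R norm n"] S(2) by auto
  have "\<exists>t. 0 \<le> t \<and> t < 2 * pi \<and> x = circle_point c r p q t" if "x \<in> S" for x
  proof -
    define v where "v = (x - c) /\<^sub>R r"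
    have v: "norm v = 1" "inner v (hopf p q) = 0"
      using that S by (auto simp: v_def pq(2) dist_norm norm_minus_commute inner_commute)
    define \<alpha> \<beta> where "\<alpha> = inner v (frame1 p q)" and "\<beta> = inner v (frame2 p q)"
    have exp: "v = \<alpha> *\<^sub>R frame1 p q + \<beta> *\<^sub>R frame2 p q"
      using frame_expansion[OF pq(1), of v] v(2) by (simp add: \<alpha>_def \<beta>_def)
    have "inner v v = \<alpha> * \<alpha> + \<beta> * \<beta>"
      by (subst (2) exp) (simp add: inner_add_right \<alpha>_def \<beta>_def)
    then have "\<alpha>\<^sup>2 + \<beta>\<^sup>2 = 1" using v(1) by (simp add: power2_eq_square norm_eq_1)
    then obtain t where t: "0 \<le> t" "t < 2 * pi" "\<alpha> = cos t" "\<beta> = sin t"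
      using sincos_total_2pi by metis
    have "x = c + r *\<^sub>R v" using S(1) by (simp add: v_def)
    then show ?thesis using t exp by (auto simp: circle_point_def)
  qed
  then show ?thesis using that S(1) pq(1) by blast
qed

text \<open>A chord is parallel to the tangent at the midpoint of its arc.\<close>

lemma circle_point_diff:
  fixes t t' :: real
  defines "u \<equiv> \<i> * cis (t / 2) * cis (t' / 2)"
  shows "circle_point c r p q t' - circle_point c r p q t =
    (2 * r * sin ((t' - t) / 2)) *\<^sub>R (Re u *\<^sub>R frame1 p q + Im u *\<^sub>R frame2 p q)"
proof -
  have u: "Re u = - sin ((t + t') / 2)" "Im u = cos ((t + t') / 2)"
    by (simp_all add: u_def cis_mult mult.assoc add_divide_distrib)
  have "sin ((t - t') / 2) = - sin ((t' - t) / 2)"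
    by (metis minus_diff_eq minus_divide_left sin_minus)
  then have c: "cos t' - cos t = 2 * sin ((t' - t) / 2) * Re u"
    using cos_diff_cos[of t' t] by (simp add: u add.commute)
  have s: "sin t' - sin t = 2 * sin ((t' - t) / 2) * Im u"
    using sin_diff_sin[of t' t] by (simp add: u add.commute)
  have "circle_point c r p q t' - circle_point c r p q t =
     r *\<^sub>R ((cos t' - cos t) *\<^sub>R frame1 p q + (sin t' - sin t) *\<^sub>R frame2 p q)"
    by (simp add: circle_point_def algebra_simps)
  then show ?thesis unfolding c s by (simp add: algebra_simps)
qed

text \<open>The factor \<open>sin ((t' - t) / 2)\<close> in \<open>circle_point_diff\<close> is positive for increasing parameters within
  one period, so the unit complex number of a chord is known together with its sign.\<close>

lemma circle_direction_spinors:
  assumes r: "r > 0" and pq: "(cmod p)\<^sup>2 + (cmod q)\<^sup>2 = 1"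
    and ts: "\<And>i j. i < j \<Longrightarrow> j < length ts \<Longrightarrow> ts ! i < ts ! j \<and> ts ! j < ts ! i + 2 * pi"
  defines "u \<equiv> \<lambda>i k. (if i < k then \<i> else - \<i>) * cis (ts ! i / 2) * cis (ts ! k / 2)"
  shows "direction_spinors (map (circle_point c r p q) ts)
    (\<lambda>i k. (u i k * p - cnj q) / of_real (sqrt 2)) (\<lambda>i k. (u i k * q + cnj p) / of_real (sqrt 2))"
    and "distinct (map (circle_point c r p q) ts)"
proof -
  define z w where "z = (\<lambda>i k. (u i k * p - cnj q) / of_real (sqrt 2))"
    and "w = (\<lambda>i k. (u i k * q + cnj p) / of_real (sqrt 2))"
  have main: "(cmod (z i k))\<^sup>2 + (cmod (w i k))\<^sup>2 = 1 \<and> 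
      (\<exists>\<rho>>0. circle_point c r p q (ts ! k) - circle_point c r p q (ts ! i) = \<rho> *\<^sub>R hopf (z i k) (w i k))"
    if "i < length ts" "k < length ts" "i \<noteq> k" for i k
  proof -
    define \<rho> where "\<rho> = 2 * r * \<bar>sin ((ts ! k - ts ! i) / 2)\<bar>"
    have "cmod (u i k) = 1" by (simp add: u_def norm_mult)
    note eq = hopf_equator[OF this pq]
    have hopf: "hopf (z i k) (w i k) = Re (u i k) *\<^sub>R frame1 p q + Im (u i k) *\<^sub>R frame2 p q"
      using eq(2) by (simp add: z_def w_def)
    have "\<rho> > 0 \<and> circle_point c r p q (ts ! k) - circle_point c r p q (ts ! i) = \<rho> *\<^sub>R hopf (z i k) (w i k)"
    proof (cases "i < k")
      case True
      then have "sin ((ts ! k - ts ! i) / 2) > 0"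
        using ts[OF True that(2)] by (intro sin_gt_zero) auto
      then show ?thesis using r True unfolding circle_point_diff hopf by (simp add: \<rho>_def u_def)
    next
      case False
      then have ki: "k < i" using that by simp
      have "sin ((ts ! i - ts ! k) / 2) > 0"
        using ts[OF ki that(1)] by (intro sin_gt_zero) auto
      moreover have "sin ((ts ! k - ts ! i) / 2) = - sin ((ts ! i - ts ! k) / 2)"
        by (metis minus_diff_eq minus_divide_left sin_minus)
      ultimately show ?thesis using r False unfolding circle_point_diff hopf
        by (simp add: \<rho>_def u_def algebra_simps)
    qed
    then show ?thesis using eq(1) by (auto simp: z_def w_def)
  qed
  have "direction_spinors (map (circle_point c r p q) ts) z w"
    unfolding direction_spinors_def using main by (fastforce simp: norm_hopf)
  then show "direction_spinors (map (circle_point c r p q) ts)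
    (\<lambda>i k. (u i k * p - cnj q) / of_real (sqrt 2)) (\<lambda>i k. (u i k * q + cnj p) / of_real (sqrt 2))"
    by (simp add: z_def w_def)
  show "distinct (map (circle_point c r p q) ts)"
    unfolding distinct_conv_nth
  proof (intro allI impI)
    fix i k assume ik: "i < length (map (circle_point c r p q) ts)"
       "k < length (map (circle_point c r p q) ts)" "i \<noteq> k"
    then have "hopf (z i k) (w i k) \<noteq> 0" using main[of i k] norm_hopf[of "z i k" "w i k"] by auto
    then show "map (circle_point c r p q) ts ! i \<noteq> map (circle_point c r p q) ts ! k"
      using main[of i k] ik by auto
  qed
qed

section \<open>Absolute values in terms of inscribed angles\<close>

lemma cis_squares_add:
  "(cis x)\<^sup>2 + (cis y)\<^sup>2 = 2 * cis x * cis y * of_real (cos ((y - x)))"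
proof -
  have "cis x * cis y * (cis (x - y) + cis (y - x)) = (cis x)\<^sup>2 + (cis y)\<^sup>2"
    by (simp add: distrib_left power2_eq_square cis_mult)
  moreover have "cis (x - y) + cis (y - x) = 2 * of_real (cos (y - x))"
    by (simp add: complex_eq_iff cos_diff sin_diff)
  ultimately show ?thesis by (simp add: mult_ac)
qed

text \<open>The spinors of chords in the form required by the change of frame; the common factor \<open>i\<close> of the
  directions is absorbed into the frame.\<close>

lemma circle_spinors_frame:
  fixes p q x :: complex
  defines "P \<equiv> \<i> * p / of_real (sqrt 2)" and "Q \<equiv> \<i> * q / of_real (sqrt 2)"
    and "P' \<equiv> cnj p / of_real (sqrt 2)" and "Q' \<equiv> cnj q / of_real (sqrt 2)"
  shows "(\<i> * x * p - cnj q) / of_real (sqrt 2) = P * x - Q' * 1"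
    and "(\<i> * x * q + cnj p) / of_real (sqrt 2) = Q * x + P' * 1"
    and "(cmod p)\<^sup>2 + (cmod q)\<^sup>2 = 1 \<Longrightarrow> P * P' + Q * Q' = \<i> / 2"
proof -
  show "(\<i> * x * p - cnj q) / of_real (sqrt 2) = P * x - Q' * 1"
    "(\<i> * x * q + cnj p) / of_real (sqrt 2) = Q * x + P' * 1"
    by (simp_all add: P_def Q_def P'_def Q'_def diff_divide_distrib add_divide_distrib)
  assume "(cmod p)\<^sup>2 + (cmod q)\<^sup>2 = 1"
  then have "p * cnj p + q * cnj q = 1"
    by (simp add: complex_norm_square[symmetric] flip: of_real_add of_real_power)
  moreover have "complex_of_real (sqrt 2) * of_real (sqrt 2) = 2"
    by (simp flip: of_real_mult)
  then have "P * P' + Q * Q' = \<i> * (p * cnj p + q * cnj q) / 2"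
    by (simp add: P_def Q_def P'_def Q'_def add_divide_distrib distrib_left mult_ac)
  ultimately show "P * P' + Q * Q' = \<i> / 2" by simp
qed

text \<open>The frame has determinant \<open>i / 2\<close>, and its exponent in the change of frame is the number of pairs of
  points.\<close>

lemma cmod_atiyah_det_circle:
  fixes ts :: "real list"
  assumes r: "r > 0" and pq: "(cmod p)\<^sup>2 + (cmod q)\<^sup>2 = 1"
    and ts: "\<And>i j. i < j \<Longrightarrow> j < length ts \<Longrightarrow> ts ! i < ts ! j \<and> ts ! j < ts ! i + 2 * pi"
    and n: "length ts = 3 \<or> length ts = 4"
  shows "2 ^ (length ts choose 2) * cmod (atiyah_det (map (circle_point c r p q) ts)) =
    cmod (Determinant.det (atiyah_mat (length ts)
       (\<lambda>i k. (if i < k then 1 else - 1) * cis (ts ! i / 2) * cis (ts ! k / 2)) (\<lambda>i k. 1)))"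
proof -
  define v where "v = (\<lambda>i k. (if i < k then 1 else - 1) * cis (ts ! i / 2) * cis (ts ! k / 2))"
  note spin = circle_direction_spinors[OF r pq ts, of c]
  have u: "(if i < k then \<i> else - \<i>) * cis (ts ! i / 2) * cis (ts ! k / 2) = \<i> * v i k" for i k :: nat
    by (simp add: v_def)
  note det = cmod_atiyah_det[OF spin(2) spin(1), unfolded u circle_spinors_frame(1,2) length_map]
  from n show ?thesis
  proof
    assume n: "length ts = 3"
    show ?thesis
      using det unfolding n det_atiyah_mat_frame_3[OF refl refl, of _ v _ "\<lambda>i k. 1"] circle_spinors_frame(3)[OF pq]
      by (simp add: norm_mult norm_power norm_divide v_def power_divide choose_two)
  next
    assume n: "length ts = 4"
    show ?thesis
      using det unfolding n det_atiyah_mat_frame_4[OF refl refl, of _ v _ "\<lambda>i k. 1"] circle_spinors_frame(3)[OF pq]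
      by (simp add: norm_mult norm_power norm_divide v_def power_divide choose_two)
  qed
qed

lemma cmod_atiyah_det_circle_3:
  assumes "r > 0" "(cmod p)\<^sup>2 + (cmod q)\<^sup>2 = 1" "t0 < t1" "t1 < t2" "t2 < t0 + 2 * pi"
  shows "cmod (atiyah_det (map (circle_point c r p q) [t0, t1, t2])) =
    \<bar>3 + cos ((t1 - t0) / 2) + cos ((t2 - t1) / 2) - cos ((t2 - t0) / 2)\<bar> / 4"
proof -
  define a b d where "a = cis (t0 / 2)" "b = cis (t1 / 2)" "d = cis (t2 / 2)"
  define x y z where "x = cos ((t1 - t0) / 2)" "y = cos ((t2 - t1) / 2)" "z = cos ((t2 - t0) / 2)"
  have m: "a\<^sup>2 + b\<^sup>2 = 2 * a * b * of_real x" "b\<^sup>2 + d\<^sup>2 = 2 * b * d * of_real y"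
    "a\<^sup>2 + d\<^sup>2 = 2 * a * d * of_real z"
    by (simp_all add: a_b_d_def x_y_z_def cis_squares_add diff_divide_distrib)
  have "[t0, t1, t2] ! i < [t0, t1, t2] ! j \<and> [t0, t1, t2] ! j < [t0, t1, t2] ! i + 2 * pi"
    if "i < j" "j < length [t0, t1, t2]" for i j
    using that assms(3-) by (auto simp: less_Suc_eq numeral_3_eq_3)
  note circ = cmod_atiyah_det_circle[OF assms(1,2) this, of c]
  have len: "length [t0, t1, t2] = 3" by simp
  have "8 * cmod (atiyah_det (map (circle_point c r p q) [t0, t1, t2])) =
    cmod (a * b * d * (6 * a * b * d + (a\<^sup>2 + b\<^sup>2) * d + (b\<^sup>2 + d\<^sup>2) * a - (a\<^sup>2 + d\<^sup>2) * b))"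
    using circ[unfolded len] det_cocircular_3[OF refl refl, of "\<lambda>i. cis ([t0, t1, t2] ! i / 2)" a b d]
    by (simp add: a_b_d_def choose_two)
  also have "a * b * d * (6 * a * b * d + (a\<^sup>2 + b\<^sup>2) * d + (b\<^sup>2 + d\<^sup>2) * a - (a\<^sup>2 + d\<^sup>2) * b)
     = 2 * (a * b * d)\<^sup>2 * of_real (3 + x + y - z)"
    unfolding m by (simp add: power2_eq_square algebra_simps)
  also have "cmod \<dots> = 2 * \<bar>3 + x + y - z\<bar>"
    unfolding norm_mult norm_power norm_of_real by (simp add: a_b_d_def)
  finally show ?thesis by (simp add: x_y_z_def)
qed

text \<open>The cosines are those of half the differences of the parameters, that is, of inscribed angles.
  Each product is \<open>8 P C\<close> for one of the triangles.\<close>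

lemma cmod_atiyah_det_circle_4:
  assumes "r > 0" "(cmod p)\<^sup>2 + (cmod q)\<^sup>2 = 1"
    "t0 < t1" "t1 < t2" "t2 < t3" "t3 < t0 + 2 * pi"
  defines "c01 \<equiv> cos ((t1 - t0) / 2)" and "c12 \<equiv> cos ((t2 - t1) / 2)" and "c23 \<equiv> cos ((t3 - t2) / 2)"
    and "c02 \<equiv> cos ((t2 - t0) / 2)" and "c13 \<equiv> cos ((t3 - t1) / 2)" and "c03 \<equiv> cos ((t3 - t0) / 2)"
  shows "cmod (atiyah_det (map (circle_point c r p q) [t0, t1, t2, t3])) =
    \<bar>16 + (c01 + c12 - c02 - 1) * (3 + c01 + c12 + c02)
       + (c12 + c23 - c13 - 1) * (3 + c12 + c23 + c13)
       + (c23 - c03 + c02 - 1) * (3 + c23 - c03 - c02)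
       + (c01 - c03 + c13 - 1) * (3 + c01 - c03 - c13)\<bar> / 16"
proof -
  define a b d e where "a = cis (t0 / 2)" "b = cis (t1 / 2)" "d = cis (t2 / 2)" "e = cis (t3 / 2)"
  have m: "a\<^sup>2 + b\<^sup>2 = 2 * a * b * of_real c01" "b\<^sup>2 + d\<^sup>2 = 2 * b * d * of_real c12"
    "d\<^sup>2 + e\<^sup>2 = 2 * d * e * of_real c23" "a\<^sup>2 + d\<^sup>2 = 2 * a * d * of_real c02"
    "b\<^sup>2 + e\<^sup>2 = 2 * b * e * of_real c13" "a\<^sup>2 + e\<^sup>2 = 2 * a * e * of_real c03"
    by (simp_all add: a_b_d_e_def c01_def c12_def c23_def c02_def c13_def c03_def
        cis_squares_add diff_divide_distrib)
  have "[t0, t1, t2, t3] ! i < [t0, t1, t2, t3] ! j \<and> [t0, t1, t2, t3] ! j < [t0, t1, t2, t3] ! i + 2 * pi"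
    if "i < j" "j < length [t0, t1, t2, t3]" for i j
    using that assms(3-6) by (auto simp: less_Suc_eq)
  note circ = cmod_atiyah_det_circle[OF assms(1,2) this, of c]
  have len: "length [t0, t1, t2, t3] = 4" by simp
  have "64 * cmod (atiyah_det (map (circle_point c r p q) [t0, t1, t2, t3])) =
    cmod (a * b * d * e *
    (64 * (a * b * d * e)^2
     + e^2 * ((a^2 + b^2) * d + (b^2 + d^2) * a - (a^2 + d^2) * b - 2 * a * b * d)
           * (6 * a * b * d + (a^2 + b^2) * d + (b^2 + d^2) * a + (a^2 + d^2) * b)
     + a^2 * ((b^2 + d^2) * e + (d^2 + e^2) * b - (b^2 + e^2) * d - 2 * b * d * e)
           * (6 * b * d * e + (b^2 + d^2) * e + (d^2 + e^2) * b + (b^2 + e^2) * d)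
     + b^2 * ((d^2 + e^2) * a - (a^2 + e^2) * d + (a^2 + d^2) * e - 2 * a * d * e)
           * (6 * a * d * e + (d^2 + e^2) * a - (a^2 + e^2) * d - (a^2 + d^2) * e)
     + d^2 * ((a^2 + b^2) * e + (b^2 + e^2) * a - (a^2 + e^2) * b - 2 * a * b * e)
           * (6 * a * b * e + (a^2 + b^2) * e - (b^2 + e^2) * a - (a^2 + e^2) * b)))"
    using circ[unfolded len] det_cocircular_4[OF refl refl, of "\<lambda>i. cis ([t0, t1, t2, t3] ! i / 2)" a b d e]
    by (simp add: a_b_d_e_def choose_two)
  also have "a * b * d * e *
    (64 * (a * b * d * e)^2
     + e^2 * ((a^2 + b^2) * d + (b^2 + d^2) * a - (a^2 + d^2) * b - 2 * a * b * d)
           * (6 * a * b * d + (a^2 + b^2) * d + (b^2 + d^2) * a + (a^2 + d^2) * b)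
     + a^2 * ((b^2 + d^2) * e + (d^2 + e^2) * b - (b^2 + e^2) * d - 2 * b * d * e)
           * (6 * b * d * e + (b^2 + d^2) * e + (d^2 + e^2) * b + (b^2 + e^2) * d)
     + b^2 * ((d^2 + e^2) * a - (a^2 + e^2) * d + (a^2 + d^2) * e - 2 * a * d * e)
           * (6 * a * d * e + (d^2 + e^2) * a - (a^2 + e^2) * d - (a^2 + d^2) * e)
     + d^2 * ((a^2 + b^2) * e + (b^2 + e^2) * a - (a^2 + e^2) * b - 2 * a * b * e)
           * (6 * a * b * e + (a^2 + b^2) * e - (b^2 + e^2) * a - (a^2 + e^2) * b))
    = 4 * (a * b * d * e)^3 * of_real (16 + (c01 + c12 - c02 - 1) * (3 + c01 + c12 + c02)
       + (c12 + c23 - c13 - 1) * (3 + c12 + c23 + c13)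
       + (c23 - c03 + c02 - 1) * (3 + c23 - c03 - c02)
       + (c01 - c03 + c13 - 1) * (3 + c01 - c03 - c13))"
    unfolding m of_real_add of_real_mult of_real_diff of_real_numeral of_real_1
    by (subst eq_iff_diff_eq_0) (simp add: power2_eq_square power3_eq_cube algebra_simps)
  also have "cmod \<dots> = 4 * \<bar>16 + (c01 + c12 - c02 - 1) * (3 + c01 + c12 + c02)
       + (c12 + c23 - c13 - 1) * (3 + c12 + c23 + c13)
       + (c23 - c03 + c02 - 1) * (3 + c23 - c03 - c02)
       + (c01 - c03 + c13 - 1) * (3 + c01 - c03 - c13)\<bar>"
    unfolding norm_mult norm_power norm_of_real by (simp add: a_b_d_e_def)
  finally show ?thesis by simp
qed

section \<open>The inequality\<close>

lemma half_angle_product: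
  "cos x + cos y - cos (x + y) - 1 = 4 * sin (x / 2) * sin (y / 2) * cos ((x + y) / 2)" for x y :: real
proof -
  define a b where "a = x / 2" and "b = y / 2"
  have xy: "x = 2 * a" "y = 2 * b" "x + y = 2 * (a + b)" by (simp_all add: a_def b_def)
  have "cos (2 * (a + b)) = 2 * (cos a * cos b - sin a * sin b)\<^sup>2 - 1"
    by (subst cos_double_cos) (simp add: cos_add)
  also have "\<dots> = 2 * (cos a)\<^sup>2 * (cos b)\<^sup>2 + 2 * (sin a)\<^sup>2 * (sin b)\<^sup>2
      - 4 * sin a * sin b * cos a * cos b - 1"
    by (simp add: power2_eq_square algebra_simps)
  also have "\<dots> = 2 * (1 - (sin a)\<^sup>2) * (1 - (sin b)\<^sup>2) + 2 * (sin a)\<^sup>2 * (sin b)\<^sup>2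
      - 4 * sin a * sin b * cos a * cos b - 1"
    by (simp add: cos_squared_eq)
  finally have cxy: "cos (x + y) = 2 * (1 - (sin a)\<^sup>2) * (1 - (sin b)\<^sup>2) + 2 * (sin a)\<^sup>2 * (sin b)\<^sup>2
      - 4 * sin a * sin b * cos a * cos b - 1" unfolding xy(3) .
  have cx: "cos x = 1 - 2 * (sin a)\<^sup>2" "cos y = 1 - 2 * (sin b)\<^sup>2"
    unfolding xy by (simp_all add: cos_double_sin)
  have ch: "cos ((x + y) / 2) = cos a * cos b - sin a * sin b"
    by (simp add: a_def b_def cos_add add_divide_distrib)
  show ?thesis
    unfolding cxy cx ch a_def[symmetric] b_def[symmetric] by (simp add: power2_eq_square algebra_simps)
qed

lemma half_angle_nonneg:
  fixes x y :: real
  assumes "0 < x" "0 < y" "x + y < pi"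
  shows "0 \<le> cos x + cos y - cos (x + y) - 1"
  unfolding half_angle_product using assms
  by (intro mult_nonneg_nonneg sin_ge_zero cos_ge_zero) auto

text \<open>With \<open>m\<close> and \<open>n\<close> the means of \<open>P1, P2\<close> and of \<open>P3, P4\<close>, both sides are compared with
  \<open>((1 + m) (1 + n))\<^sup>2\<close>.  On the right, the term \<open>m n\<close> is absorbed by the sum of squares that
  the lower bounds on the \<open>C\<close>'s provide.\<close>

lemma product_le_square:
  assumes P: "P1 \<ge> 0" "P2 \<ge> 0" "P3 \<ge> 0" "P4 \<ge> (0::real)"
    and C: "C1 \<ge> 1 + 2 * P1" "C2 \<ge> 1 + 2 * P2" "C3 \<ge> 1 + 2 * P3" "C4 \<ge> 1 + 2 * P4"
  shows "(1 + P1) * (1 + P2) * (1 + P3) * (1 + P4) \<le>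
    (1 + (P1 * C1 + P2 * C2 + P3 * C3 + P4 * C4) / 2)\<^sup>2"
proof -
  define m n where "m = (P1 + P2) / 2" and "n = (P3 + P4) / 2"
  have amgm: "(1 + x) * (1 + y) \<le> (1 + (x + y) / 2)\<^sup>2" for x y :: real
    using zero_le_square[of "x - y"] by (simp add: power2_eq_square field_simps)
  have mn: "m \<ge> 0" "n \<ge> 0" using P by (simp_all add: m_def n_def)
  have "((1 + P1) * (1 + P2)) * ((1 + P3) * (1 + P4)) \<le> (1 + m)\<^sup>2 * (1 + n)\<^sup>2"
    unfolding m_def n_def using P by (intro mult_mono amgm) auto
  also have "\<dots> = ((1 + m) * (1 + n))\<^sup>2" by (simp add: power_mult_distrib)
  also have "\<dots> \<le> (1 + (P1 * C1 + P2 * C2 + P3 * C3 + P4 * C4) / 2)\<^sup>2"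
  proof (rule power_mono)
    have "P1 * (1 + 2 * P1) + P2 * (1 + 2 * P2) + P3 * (1 + 2 * P3) + P4 * (1 + 2 * P4)
        \<le> P1 * C1 + P2 * C2 + P3 * C3 + P4 * C4"
      using P C by (intro add_mono mult_left_mono) auto
    moreover have "m * n \<le> P1 * P1 + P2 * P2 + P3 * P3 + P4 * P4"
    proof -
      have "m * n \<le> (m * m + n * n) / 2" using zero_le_square[of "m - n"] by (simp add: algebra_simps)
      moreover have "2 * (m * m) \<le> P1 * P1 + P2 * P2" "2 * (n * n) \<le> P3 * P3 + P4 * P4"
        using zero_le_square[of "P1 - P2"] zero_le_square[of "P3 - P4"]
        by (simp_all add: m_def n_def field_simps)
      moreover have "P1 * P1 \<ge> 0" "P2 * P2 \<ge> 0" "P3 * P3 \<ge> 0" "P4 * P4 \<ge> 0" by simp_all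
      ultimately show ?thesis by argo
    qed
    moreover have "(1 + m) * (1 + n) = 1 + (m + n) + m * n" by (simp add: algebra_simps)
    moreover have "m + n = (P1 + P2 + P3 + P4) / 2" by (simp add: m_def n_def field_simps)
    moreover have "x * (1 + 2 * x) = x + 2 * (x * x)" for x :: real by (simp add: algebra_simps)
    ultimately show "(1 + m) * (1 + n) \<le> 1 + (P1 * C1 + P2 * C2 + P3 * C3 + P4 * C4) / 2"
      by simp argo
  qed (use mn in simp)
  finally show ?thesis by (simp add: mult.assoc)
qed

text \<open>In \<open>P a b c\<close> and \<open>C a b c\<close> of the proof, \<open>a\<close> and \<open>b\<close> are the cosines of the inscribed angles
  over the two arcs of a triangle that avoid the omitted point, and \<open>c\<close> is the cosine of the sum
  of these angles.\<close>

lemma atiyah_det_circle_ineq: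
  fixes c :: "real^3"
  assumes rpq: "r > 0" "(cmod p)\<^sup>2 + (cmod q)\<^sup>2 = 1"
    and t: "t0 < t1" "t1 < t2" "t2 < t3" "t3 < t0 + 2 * pi"
  defines "x \<equiv> circle_point c r p q"
  shows "cmod (atiyah_det [x t1, x t2, x t3]) * cmod (atiyah_det [x t0, x t2, x t3]) *
    cmod (atiyah_det [x t0, x t1, x t3]) * cmod (atiyah_det [x t0, x t1, x t2])
    \<le> (cmod (atiyah_det [x t0, x t1, x t2, x t3]))\<^sup>2"
proof -
  define c01 c12 c23 c02 c13 c03 where "c01 = cos ((t1 - t0) / 2)" and "c12 = cos ((t2 - t1) / 2)"
    and "c23 = cos ((t3 - t2) / 2)" and "c02 = cos ((t2 - t0) / 2)"
    and "c13 = cos ((t3 - t1) / 2)" and "c03 = cos ((t3 - t0) / 2)"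
  note c_defs = this
  define P where "P a b c = (a + b - c - 1) / 4" for a b c :: real
  define C where "C a b c = (3 + a + b + c) / 2" for a b c :: real
  \<comment> \<open>The inscribed angle over the arc from the last point back to the first; the four angles over
    the sides of the quadrilateral have sum \<open>pi\<close>.\<close>
  define d where "d = pi - (t3 - t0) / 2"
  have nonneg: "P (cos a) (cos b) (cos (a + b)) \<ge> 0" if "a > 0" "b > 0" "a + b < pi" for a b
    using half_angle_nonneg[OF that] by (simp add: P_def)
  have sums: "(t1 - t0) / 2 + (t2 - t1) / 2 = (t2 - t0) / 2" "(t2 - t1) / 2 + (t3 - t2) / 2 = (t3 - t1) / 2"
    "(t3 - t2) / 2 + d = pi - (t2 - t0) / 2" "(t1 - t0) / 2 + d = pi - (t3 - t1) / 2"
    by (simp_all add: d_def field_simps)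
  have cd: "cos d = - c03" by (simp add: d_def c_defs)
  have d: "d > 0" using t by (simp add: d_def)
  have P: "P c12 c23 c13 \<ge> 0" "P c23 (- c03) (- c02) \<ge> 0" "P c01 (- c03) (- c13) \<ge> 0" "P c01 c12 c02 \<ge> 0"
    using nonneg[of "(t2 - t1) / 2" "(t3 - t2) / 2"] nonneg[of "(t3 - t2) / 2" d]
      nonneg[of "(t1 - t0) / 2" d] nonneg[of "(t1 - t0) / 2" "(t2 - t1) / 2"] t d
    unfolding sums cd by (simp_all add: c_defs)
  \<comment> \<open>The difference of the two sides is \<open>1 + c\<close>.\<close>
  have C: "C a b c \<ge> 1 + 2 * P a b c" if "c \<ge> - 1" for a b c
    using that by (simp add: C_def P_def field_simps)
  have C: "C c12 c23 c13 \<ge> 1 + 2 * P c12 c23 c13" "C c23 (- c03) (- c02) \<ge> 1 + 2 * P c23 (- c03) (- c02)"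
    "C c01 (- c03) (- c13) \<ge> 1 + 2 * P c01 (- c03) (- c13)" "C c01 c12 c02 \<ge> 1 + 2 * P c01 c12 c02"
    by (intro C; simp add: c_defs)+
  have D3: "cmod (atiyah_det [x t1, x t2, x t3]) = 1 + P c12 c23 c13"
    "cmod (atiyah_det [x t0, x t2, x t3]) = 1 + P c23 (- c03) (- c02)"
    "cmod (atiyah_det [x t0, x t1, x t3]) = 1 + P c01 (- c03) (- c13)"
    "cmod (atiyah_det [x t0, x t1, x t2]) = 1 + P c01 c12 c02"
    using cmod_atiyah_det_circle_3[OF rpq, of t1 t2 t3 c] cmod_atiyah_det_circle_3[OF rpq, of t0 t2 t3 c]
      cmod_atiyah_det_circle_3[OF rpq, of t0 t1 t3 c] cmod_atiyah_det_circle_3[OF rpq, of t0 t1 t2 c] t P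
    unfolding x_def P_def by (simp_all add: c_defs[symmetric] field_simps)
  define E where "E = P c12 c23 c13 * C c12 c23 c13 + P c23 (- c03) (- c02) * C c23 (- c03) (- c02)
     + P c01 (- c03) (- c13) * C c01 (- c03) (- c13) + P c01 c12 c02 * C c01 c12 c02"
  have "E \<ge> 0" unfolding E_def using P C by (intro add_nonneg_nonneg mult_nonneg_nonneg) auto
  have abs16: "\<bar>y\<bar> / 16 = \<bar>y / 16\<bar>" for y :: real by simp
  have "cmod (atiyah_det (map (circle_point c r p q) [t0, t1, t2, t3])) = \<bar>1 + E / 2\<bar>"
    unfolding cmod_atiyah_det_circle_4[OF rpq t] c_defs[symmetric] abs16
    by (rule arg_cong[of _ _ abs]) (simp add: E_def P_def C_def field_simps)
  then have D4: "cmod (atiyah_det [x t0, x t1, x t2, x t3]) = 1 + E / 2"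
    using \<open>E \<ge> 0\<close> by (simp add: x_def)
  show ?thesis unfolding D3 D4 E_def using P C by (rule product_le_square)
qed

text \<open>Taking the product over the set of points puts the right-hand side of the theorem into a form that
  is visibly independent of the order of the points.\<close>

lemma prod_atiyah_det_remove1_cong:
  assumes "distinct xs" "mset ys = mset xs"
  shows "(\<Prod>x\<in>set ys. cmod (atiyah_det (remove1 x ys))) = (\<Prod>x\<in>set xs. cmod (atiyah_det (remove1 x xs)))"
  using assms by (intro prod.cong cmod_atiyah_det_permute) (auto dest: mset_eq_setD)

theorem theorem3p16:
  fixes x1 x2 x3 x4 :: "real^3" and S :: "(real^3) set"
  assumes "distinct [x1, x2, x3, x4]"
    and "is_circle S" and "{x1, x2, x3, x4} \<subseteq> S"
  shows "(cmod (atiyah_det [x1, x2, x3, x4]))\<^sup>2 \<ge>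
    cmod (atiyah_det [x2, x3, x4]) * cmod (atiyah_det [x1, x3, x4]) *
    cmod (atiyah_det [x1, x2, x4]) * cmod (atiyah_det [x1, x2, x3])"
proof -
  let ?xs = "[x1, x2, x3, x4]"
  obtain c r p q where rpq: "r > 0" "(cmod p)\<^sup>2 + (cmod q)\<^sup>2 = 1"
    and circ: "\<And>x. x \<in> S \<Longrightarrow> \<exists>t. 0 \<le> t \<and> t < 2 * pi \<and> x = circle_point c r p q t"
    using circle_parametrization[OF assms(2)] by metis
  obtain f where f: "\<And>x. x \<in> S \<Longrightarrow> 0 \<le> f x \<and> f x < 2 * pi \<and> x = circle_point c r p q (f x)"
    using circ by metis
  \<comment> \<open>Sorting by the parameter puts the points into their cyclic order.\<close>
  define ys where "ys = sort_key f ?xs"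
  have ms: "mset ys = mset ?xs" unfolding ys_def by (rule mset_sort)
  have "length ys = 4" using mset_eq_length[OF ms] by simp
  then obtain y0 y1 y2 y3 where ys: "ys = [y0, y1, y2, y3]"
    by (auto simp: length_Suc_conv eval_nat_numeral)
  have dist: "distinct ys" using assms(1) mset_eq_imp_distinct_iff[OF ms] by blast
  have "set ys = set ?xs" using ms by (rule mset_eq_setD)
  then have inS: "y0 \<in> S" "y1 \<in> S" "y2 \<in> S" "y3 \<in> S" using assms(3) by (auto simp: ys)
  have inj: "f x \<noteq> f y" if "x \<in> S" "y \<in> S" "x \<noteq> y" for x y using f that by metis
  have "sorted (map f ys)" unfolding ys_def by (rule sorted_sort_key)
  then have "f y0 < f y1" "f y1 < f y2" "f y2 < f y3"
    using dist inj inS by (simp_all add: ys order_le_less)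
  moreover have "f y3 < f y0 + 2 * pi" using f[OF inS(1)] f[OF inS(4)] by linarith
  ultimately have ineq: "cmod (atiyah_det [y1, y2, y3]) * cmod (atiyah_det [y0, y2, y3]) *
    cmod (atiyah_det [y0, y1, y3]) * cmod (atiyah_det [y0, y1, y2]) \<le> (cmod (atiyah_det ys))\<^sup>2"
    using atiyah_det_circle_ineq[OF rpq, of "f y0" "f y1" "f y2" "f y3" c]
    by (simp add: ys f[OF inS(1), THEN conjunct2, THEN conjunct2, symmetric]
       f[OF inS(2), THEN conjunct2, THEN conjunct2, symmetric]
       f[OF inS(3), THEN conjunct2, THEN conjunct2, symmetric]
       f[OF inS(4), THEN conjunct2, THEN conjunct2, symmetric])
  have prod: "(\<Prod>x\<in>set [a,b,c,d]. cmod (atiyah_det (remove1 x [a,b,c,d]))) =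
    cmod (atiyah_det [b, c, d]) * cmod (atiyah_det [a, c, d]) *
    cmod (atiyah_det [a, b, d]) * cmod (atiyah_det [a, b, c])" if "distinct [a, b, c, d]" for a b c d :: "real^3"
    using that by (auto simp: mult.assoc)
  show ?thesis
    using ineq prod_atiyah_det_remove1_cong[OF assms(1) ms] cmod_atiyah_det_permute[OF assms(1) ms]
      prod[OF assms(1)] prod[of y0 y1 y2 y3] dist by (simp add: ys)
qed

end
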